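(* For every positive integer $k$, $$\chi(QI(k^2,k))\le\binom{k+1}{2}.$$
   Context: $\chi$ denotes the chromatic number. $QI(k^2,k)$ is the graph whose vertices are all partitions of $\{1,\dots,k^2\}$ into $k$ classes in which every class has size at least $k$ (equivalently, exactly $k$); two distinct vertices $P=\{P_1,\dots,P_k\}$ and $Q=\{Q_1,\dots,Q_k\}$ are adjacent if and only if they are qualitatively independent, i.e. $P_i\cap Q_j\neq\emptyset$ for all $i,j\in\{1,\dots,k\}$. *)

theory Defs
  imports "Graph_Theory.Pair_Digraph" "HOL-Library.Disjoint_Sets"
begin

text \<open>Undirected simple graphs are symmetric, loop-free digraphs without parallel arcs
  (locale \<open>pair_graph\<close>): an edge \<open>{u, v}\<close> is the pair of arcs \<open>(u, v)\<close> and \<open>(v, u)\<close>.\<close>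

definition proper_coloring :: "'a pair_pre_digraph \<Rightarrow> ('a \<Rightarrow> 'c) \<Rightarrow> bool" where
  "proper_coloring G c \<longleftrightarrow> (\<forall>(u, v) \<in> parcs G. c u \<noteq> c v)"

definition colorable :: "'a pair_pre_digraph \<Rightarrow> nat \<Rightarrow> bool" where
  "colorable G n \<longleftrightarrow> (\<exists>c :: 'a \<Rightarrow> nat. c ` pverts G \<subseteq> {..<n} \<and> proper_coloring G c)"

text \<open>Meaningful only when some finite number of colours suffices, in particular for every
  finite loop-free graph (lemma \<open>colorable_chromatic_number\<close>).\<close>

definition chromatic_number :: "'a pair_pre_digraph \<Rightarrow> nat" where
  "chromatic_number G = (LEAST n. colorable G n)"

lemma (in pair_graph) colorable_chromatic_number: "colorable G (chromatic_number G)"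
proof -
  obtain c :: "'a \<Rightarrow> nat" where c: "bij_betw c (pverts G) {0..<card (pverts G)}"
    using ex_bij_betw_finite_nat[OF pair_finite_verts] by blast
  have "c u \<noteq> c v" if "(u, v) \<in> parcs G" for u v
    using that c in_arcsD1[OF that] in_arcsD2[OF that] pair_no_loops[OF that]
    by (auto simp: bij_betw_def dest: inj_onD)
  moreover have "c ` pverts G \<subseteq> {..<card (pverts G)}"
    using c by (auto simp: bij_betw_def)
  ultimately have "colorable G (card (pverts G))"
    by (auto simp: colorable_def proper_coloring_def)
  then show ?thesis
    unfolding chromatic_number_def by (rule LeastI)
qed

definition qualitatively_independent :: "'a set set \<Rightarrow> 'a set set \<Rightarrow> bool" where
  "qualitatively_independent P Q \<longleftrightarrow> (\<forall>A \<in> P. \<forall>B \<in> Q. A \<inter> B \<noteq> {})"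

definition QI_verts :: "nat \<Rightarrow> nat \<Rightarrow> nat set set set" where
  "QI_verts n k = {P. partition_on {1..n} P \<and> card P = k \<and> (\<forall>A \<in> P. k \<le> card A)}"

definition QI :: "nat \<Rightarrow> nat \<Rightarrow> nat set set pair_pre_digraph" where
  "QI n k = \<lparr> pverts = QI_verts n k,
     parcs = {(P, Q). P \<in> QI_verts n k \<and> Q \<in> QI_verts n k \<and> P \<noteq> Q \<and>
       qualitatively_independent P Q} \<rparr>"

lemma finite_QI_verts: "finite (QI_verts n k)"
proof (rule finite_subset)
  show "QI_verts n k \<subseteq> Pow (Pow {1..n})"
    by (auto simp: QI_verts_def partition_on_def)
qed simp

lemma pair_graph_QI: "pair_graph (QI n k)"
proof
  show "finite (pverts (QI n k))"
    by (simp add: QI_def finite_QI_verts)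
  show "finite (parcs (QI n k))"
    by (rule finite_subset[of _ "QI_verts n k \<times> QI_verts n k"])
      (auto simp: QI_def finite_QI_verts)
qed (auto simp: QI_def symmetric_def sym_def qualitatively_independent_def Int_commute)

end

theory Submission
  imports Defs
begin

text \<open>A partition of a \<open>k\<^sup>2\<close>-set into \<open>k\<close> classes of size at least \<open>k\<close> has all its classes of
  size exactly \<open>k\<close>. Hence, if \<open>P\<close> and \<open>Q\<close> are qualitatively independent, the \<open>k\<close> classes of \<open>Q\<close>
  cut each class of \<open>P\<close> into \<open>k\<close> nonempty pieces, all of them singletons: no two points lie
  together both in a class of \<open>P\<close> and in a class of \<open>Q\<close>
  (lemma \<open>qualitatively_independent_Int_card\<close>).

  So a pair of points joined by a class of \<open>P\<close> is a legitimate colour for \<open>P\<close>. By the pigeonhole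
  principle such a pair can always be found among the \<open>k + 1\<close> points \<open>1, \<dots>, k + 1\<close>
  (lemma \<open>partition_joins_pair\<close>), which leaves \<open>(k + 1) choose 2\<close> colours. These points exist
  only if \<open>k + 1 \<le> k\<^sup>2\<close>, that is, for \<open>k \<ge> 2\<close>; for \<open>k = 1\<close> the graph is a single vertex.\<close>

lemma (in pair_wf_digraph) chromatic_number_le_card:
  assumes "finite S" and "c ` pverts G \<subseteq> S" and "proper_coloring G c"
  shows "chromatic_number G \<le> card S"
proof -
  obtain f :: "'b \<Rightarrow> nat" where f: "bij_betw f S {0..<card S}"
    using ex_bij_betw_finite_nat[OF assms(1)] by blast
  have "proper_coloring G (f \<circ> c)"
    unfolding proper_coloring_def
  proof clarify
    fix u v assume uv: "(u, v) \<in> parcs G" and eq: "(f \<circ> c) u = (f \<circ> c) v"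
    have "c u \<in> S" "c v \<in> S"
      using assms(2) in_arcsD1[OF uv] in_arcsD2[OF uv] by auto
    with eq f have "c u = c v" by (auto simp: bij_betw_def dest: inj_onD)
    with uv assms(3) show False by (auto simp: proper_coloring_def)
  qed
  moreover have "(f \<circ> c) ` pverts G \<subseteq> {..<card S}"
    using bij_betwE[OF f] assms(2) by auto
  ultimately have "colorable G (card S)"
    unfolding colorable_def by blast
  then show ?thesis
    unfolding chromatic_number_def by (rule Least_le)
qed

lemma partition_on_sum_card_Int:
  assumes "partition_on X P" and "finite X" and "A \<subseteq> X"
  shows "(\<Sum>B\<in>P. card (A \<inter> B)) = card A"
proof -
  have "finite P" using assms(1,2) by (rule finite_elements[rotated])
  moreover have "finite A" using assms(2,3) finite_subset by blast
  moreover have "\<forall>B\<in>P. \<forall>C\<in>P. B \<noteq> C \<longrightarrow> (A \<inter> B) \<inter> (A \<inter> C) = {}"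
    using assms(1) by (auto simp: partition_on_def disjoint_def)
  ultimately have "card (\<Union>B\<in>P. A \<inter> B) = (\<Sum>B\<in>P. card (A \<inter> B))"
    by (intro card_UN_disjoint) auto
  moreover have "(\<Union>B\<in>P. A \<inter> B) = A"
    using assms(1,3) by (auto simp: partition_on_def)
  ultimately show ?thesis by simp
qed

lemma QI_verts_card_class:
  assumes P: "P \<in> QI_verts (k^2) k" and A: "A \<in> P"
  shows "card A = k"
proof -
  have part: "partition_on {1..k^2} P" and card_P: "card P = k"
    and large: "\<And>B. B \<in> P \<Longrightarrow> k \<le> card B"
    using P by (auto simp: QI_verts_def)
  have "(\<Sum>B\<in>P. card B) = (\<Sum>B\<in>P. card ({1..k^2} \<inter> B))"
  proof (intro sum.cong refl)
    fix B assume "B \<in> P"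
    then have "B \<subseteq> {1..k^2}" using part by (auto simp only: partition_on_def)
    then show "card B = card ({1..k^2} \<inter> B)" by (simp only: Int_absorb1)
  qed
  also have "\<dots> = k^2"
    using partition_on_sum_card_Int[OF part] by simp
  finally have "(\<Sum>B\<in>P. k) = (\<Sum>B\<in>P. card B)"
    using card_P by (simp add: power2_eq_square)
  then have "k = card A"
    using large A finite_elements[OF finite_atLeastAtMost part] by (rule sum_mono_inv)
  then show ?thesis ..
qed

text \<open>The \<open>k\<close> pieces into which the classes of \<open>Q\<close> cut \<open>A\<close> have at least one element each and
  \<open>k\<close> elements altogether.\<close>

lemma qualitatively_independent_Int_card:
  assumes P: "P \<in> QI_verts (k^2) k" and Q: "Q \<in> QI_verts (k^2) k"
    and ind: "qualitatively_independent P Q" and A: "A \<in> P" and B: "B \<in> Q"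
  shows "card (A \<inter> B) = 1"
proof -
  have part: "partition_on {1..k^2} Q" and card_Q: "card Q = k"
    using Q by (auto simp: QI_verts_def)
  have A_sub: "A \<subseteq> {1..k^2}"
    using P A by (auto simp: QI_verts_def partition_on_def)
  then have fin: "finite A" using finite_subset by blast
  have "(\<Sum>C\<in>Q. 1) = (\<Sum>C\<in>Q. card (A \<inter> C))"
    using partition_on_sum_card_Int[OF part _ A_sub] QI_verts_card_class[OF P A] card_Q by simp
  then have "1 = card (A \<inter> B)"
  proof (rule sum_mono_inv[OF _ _ B finite_elements[OF finite_atLeastAtMost part]])
    show "1 \<le> card (A \<inter> C)" if "C \<in> Q" for C
      using ind A that fin by (auto simp: qualitatively_independent_def Suc_le_eq card_gt_0_iff)
  qed
  then show ?thesis ..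
qed

lemma partition_joins_pair:
  assumes "partition_on X P" and "finite P" and "Y \<subseteq> X" and "card P < card Y"
  shows "\<exists>e. e \<subseteq> Y \<and> card e = 2 \<and> (\<exists>A\<in>P. e \<subseteq> A)"
proof -
  have "\<forall>y\<in>Y. \<exists>A\<in>P. y \<in> A"
    using assms(1,3) by (auto simp: partition_on_def)
  then obtain cls where cls: "\<And>y. y \<in> Y \<Longrightarrow> cls y \<in> P \<and> y \<in> cls y"
    by metis
  have "card (cls ` Y) \<le> card P"
    using cls assms(2) by (intro card_mono) auto
  then have "\<not> inj_on cls Y"
    using assms(4) by (intro pigeonhole) simp
  then obtain x y where xy: "x \<in> Y" "y \<in> Y" "x \<noteq> y" "cls x = cls y"
    by (auto simp: inj_on_def)
  show ?thesis
  proof (intro exI conjI bexI)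
    show "{x, y} \<subseteq> cls x" using cls[OF xy(1)] cls[OF xy(2)] xy(4) by auto
  qed (use xy cls in auto)
qed

lemma QI_verts_1: "QI_verts 1 1 \<subseteq> {{{1}}}"
  by (auto simp: QI_verts_def partition_on_def card_1_singleton_iff)

theorem theorem5p4p2:
  fixes k :: nat
  assumes "k > 0"
  shows "chromatic_number (QI (k^2) k) \<le> (k + 1) choose 2"
proof -
  interpret pair_graph "QI (k^2) k" by (rule pair_graph_QI)
  show ?thesis
  proof (cases "k = 1")
    case True
    then have "proper_coloring (QI (k^2) k) (\<lambda>_. ())"
      using QI_verts_1 by (auto simp: proper_coloring_def QI_def)
    then have "chromatic_number (QI (k^2) k) \<le> card {()}"
      by (intro chromatic_number_le_card) auto
    with True show ?thesis by (simp add: choose_two)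
  next
    case False
    with assms have "2 \<le> k" by simp
    then have "k + 1 \<le> k * 2" by simp
    also have "\<dots> \<le> k^2" using \<open>2 \<le> k\<close> by (simp add: power2_eq_square)
    finally have room: "{1..k + 1} \<subseteq> {1..k^2}" by simp
    define pairs where "pairs = {e. e \<subseteq> {1..k + 1} \<and> card e = 2}"
    have "\<exists>e\<in>pairs. \<exists>A\<in>P. e \<subseteq> A" if "P \<in> QI_verts (k^2) k" for P
    proof -
      have part: "partition_on {1..k^2} P" and "card P = k"
        using that by (auto simp: QI_verts_def)
      then show ?thesis
        using partition_joins_pair[OF part finite_elements[OF _ part] room]
        by (auto simp: pairs_def)
    qed
    then obtain c where c: "\<And>P. P \<in> QI_verts (k^2) k \<Longrightarrow> c P \<in> pairs \<and> (\<exists>A\<in>P. c P \<subseteq> A)"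
      by metis
    have "proper_coloring (QI (k^2) k) c"
      unfolding proper_coloring_def
    proof clarify
      fix P Q assume "(P, Q) \<in> parcs (QI (k^2) k)" and eq: "c P = c Q"
      then have P: "P \<in> QI_verts (k^2) k" and Q: "Q \<in> QI_verts (k^2) k"
        and ind: "qualitatively_independent P Q"
        by (auto simp: QI_def)
      obtain A B where A: "A \<in> P" "c P \<subseteq> A" and B: "B \<in> Q" "c P \<subseteq> B"
        using c[OF P] c[OF Q] eq by auto
      have one: "card (A \<inter> B) = 1"
        by (rule qualitatively_independent_Int_card[OF P Q ind A(1) B(1)])
      then have "card (c P) \<le> card (A \<inter> B)"
        using A B by (intro card_mono) (auto intro: card_ge_0_finite)
      with one c[OF P] show False by (simp add: pairs_def)
    qed
    moreover have "c ` pverts (QI (k^2) k) \<subseteq> pairs"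
      using c by (auto simp: QI_def)
    moreover have "finite pairs" by (simp add: pairs_def)
    ultimately have "chromatic_number (QI (k^2) k) \<le> card pairs"
      by (intro chromatic_number_le_card)
    also have "card pairs = (k + 1) choose 2"
      using n_subsets[of "{1..k + 1}" 2] by (simp add: pairs_def)
    finally show ?thesis .
  qed
qed

end
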